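(* Let $p$ be a prime and let $A(x),B(x)\in\mathbb{Z}[x]$ be monic polynomials, coprime in $\mathbb{Q}[x]$, of degrees $d$ and $e$, such that both are split with simple roots modulo $p$. Let $p^\omega$ be the largest power of $p$ dividing some value $\gcd(A(n),B(n))$, $n\in\mathbb{Z}$. Let $r_1,\dots,r_d\in\mathbb{Z}$ be pairwise distinct modulo $p$ with $A(x)\equiv(x-r_1)\cdots(x-r_d)\pmod{p^\omega}$, and let $s_1,\dots,s_e\in\mathbb{Z}$ be pairwise distinct modulo $p$ with $B(x)\equiv(x-s_1)\cdots(x-s_e)\pmod{p^\omega}$ (congruences of polynomials, i.e. coefficientwise). Let $n\in\mathbb{Z}$. If there exist $1\le i\le d$ and $1\le j\le e$ with $n\equiv r_i\equiv s_j\pmod p$, then $$\gcd\big(A(n),B(n),p^\omega\big)=\gcd\big(n-r_i,\;r_i-s_j,\;p^\omega\big).$$ Otherwise $\gcd(A(n),B(n),p^\omega)=1$.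
   Context: A monic polynomial $A(x)\in\mathbb{Z}[x]$ is split with simple roots modulo $p$ if its reduction in $(\mathbb{Z}/p\mathbb{Z})[x]$ factors as $(x-\rho_1)\cdots(x-\rho_d)$ with $\rho_1,\dots,\rho_d$ pairwise distinct in $\mathbb{Z}/p\mathbb{Z}$. (By Hensel's lemma such a factorization lifts modulo any power of $p$, so integers $r_i$, $s_j$ as in the statement exist.) *)

theory Defs
  imports
    "HOL-Computational_Algebra.Computational_Algebra"
    "HOL-Number_Theory.Cong"
begin

definition poly_cong :: "int poly \<Rightarrow> int poly \<Rightarrow> int \<Rightarrow> bool" where
  "poly_cong f g m \<longleftrightarrow> (\<forall>k. [coeff f k = coeff g k] (mod m))"

text \<open>The residues \<open>\<rho>\<^sub>1, \<dots>, \<rho>\<^sub>d\<close> in \<open>\<int>/p\<int>\<close> are given by integer representatives,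
  and the factorization over \<open>\<int>/p\<int>\<close> is a coefficientwise congruence.\<close>

definition split_simple_roots_mod :: "int \<Rightarrow> int poly \<Rightarrow> bool" where
  "split_simple_roots_mod p A \<longleftrightarrow>
     (\<exists>\<rho> :: nat \<Rightarrow> int.
        pairwise (\<lambda>i j. [\<rho> i \<noteq> \<rho> j] (mod p)) {1..degree A} \<and>
        poly_cong A (\<Prod>i = 1..degree A. [:- \<rho> i, 1:]) p)"

text \<open>For \<open>p\<close> prime and \<open>A\<close>, \<open>B\<close> coprime over \<open>\<rat>\<close>, the exponents \<open>k\<close> below are bounded: a Bezout
  relation with denominators cleared gives a nonzero integer divisible by every
  \<open>gcd (poly A n) (poly B n)\<close>. So the greatest one exists; without coprimality it need not.\<close>

definition max_gcd_exponent :: "int \<Rightarrow> int poly \<Rightarrow> int poly \<Rightarrow> nat" where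
  "max_gcd_exponent p A B = (GREATEST k. \<exists>n. p ^ k dvd gcd (poly A n) (poly B n))"

end

theory Submission
  imports Defs
begin

text \<open>Modulo \<open>p\<^sup>\<omega>\<close> the value \<open>A(n)\<close> is the product of the \<open>n - r\<^sub>k\<close>. Since the \<open>r\<^sub>k\<close> are distinct
  modulo \<open>p\<close>, at most one factor is divisible by \<open>p\<close> and the others are units modulo \<open>p\<^sup>\<omega>\<close>; so
  \<open>gcd(A(n), p\<^sup>\<omega>)\<close> is \<open>gcd(n - r\<^sub>i, p\<^sup>\<omega>)\<close> if \<open>n \<equiv> r\<^sub>i\<close> modulo \<open>p\<close>, and \<open>1\<close> if there is no such \<open>i\<close>.
  Combine this with the same statement for \<open>B\<close>.\<close>

text \<open>Coefficientwise congruence amounts to divisibility of \<open>f - g\<close> by the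
  constant polynomial \<open>[:m:]\<close>, and evaluating the quotient at \<open>x\<close> carries
  this over to values.\<close>

lemma poly_cong_imp_cong_poly:
  assumes "poly_cong f g m"
  shows "[poly f x = poly g x] (mod m)"
proof -
  have "[:m:] dvd f - g"
    using assms by (simp add: const_poly_dvd_iff poly_cong_def cong_iff_dvd_diff)
  then obtain h where "f - g = [:m:] * h" ..
  then have "poly f x - poly g x = m * poly h x"
    by (metis poly_diff poly_mult poly_const_conv)
  then show ?thesis
    by (simp add: cong_iff_dvd_diff)
qed

lemma gcd_poly_eq_gcd_prod:
  fixes r :: "'a \<Rightarrow> int"
  assumes "poly_cong A (\<Prod>i\<in>I. [:- r i, 1:]) m"
  shows "gcd (poly A n) m = gcd (\<Prod>i\<in>I. n - r i) m"
  using cong_gcd_eq[OF poly_cong_imp_cong_poly[OF assms, of n]] by (simp add: poly_prod)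

lemma gcd_poly_eq_gcd_root:
  fixes p :: int
  assumes "prime p" and "finite I" and "i \<in> I"
    and "pairwise (\<lambda>i j. [r i \<noteq> r j] (mod p)) I"
    and "poly_cong A (\<Prod>i\<in>I. [:- r i, 1:]) (p ^ w)"
    and "[n = r i] (mod p)"
  shows "gcd (poly A n) (p ^ w) = gcd (n - r i) (p ^ w)"
proof -
  have "coprime (n - r k) (p ^ w)" if "k \<in> I - {i}" for k
  proof -
    have "[r i \<noteq> r k] (mod p)"
      using assms(3,4) that by (auto simp: pairwise_def)
    \<comment> \<open>Otherwise \<open>r i\<close>, \<open>n\<close> and \<open>r k\<close> would
      all agree modulo \<open>p\<close>.\<close>
    then have "\<not> p dvd n - r k"
      using assms(6) by (metis cong_iff_dvd_diff cong_sym cong_trans)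
    then show ?thesis
      using assms(1) by (simp add: prime_imp_coprime coprime_commute)
  qed
  then have "coprime (\<Prod>k\<in>I - {i}. n - r k) (p ^ w)"
    by (rule prod_coprime_left)
  moreover have "(\<Prod>k\<in>I. n - r k) = (n - r i) * (\<Prod>k\<in>I - {i}. n - r k)"
    using assms(2,3) by (rule prod.remove)
  ultimately have "gcd (\<Prod>k\<in>I. n - r k) (p ^ w) = gcd (n - r i) (p ^ w)"
    by (simp add: gcd_mult_left_right_cancel coprime_commute)
  then show ?thesis
    by (simp add: gcd_poly_eq_gcd_prod[OF assms(5)])
qed

text \<open>By contraposition: if \<open>p\<close> divides no factor \<open>n - r i\<close>, then
  every factor, and hence the product, is coprime to \<open>p ^ w\<close>.\<close>

lemma exists_root_if_not_coprime:
  fixes p :: int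
  assumes "prime p" and "poly_cong A (\<Prod>i\<in>I. [:- r i, 1:]) (p ^ w)"
    and "\<not> coprime (poly A n) (p ^ w)"
  shows "\<exists>i\<in>I. [n = r i] (mod p)"
proof (rule ccontr)
  assume "\<not> (\<exists>i\<in>I. [n = r i] (mod p))"
  then have "coprime (n - r i) (p ^ w)" if "i \<in> I" for i
    using that assms(1) by (simp add: cong_iff_dvd_diff prime_imp_coprime coprime_commute)
  then have "coprime (\<Prod>i\<in>I. n - r i) (p ^ w)"
    by (rule prod_coprime_left)
  then show False
    using assms(3) by (simp add: coprime_iff_gcd_eq_1 gcd_poly_eq_gcd_prod[OF assms(2)])
qed

theorem theorem11:
  fixes p :: int and A B :: "int poly" and d e \<omega> :: nat
    and r s :: "nat \<Rightarrow> int" and n :: int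
  assumes "prime p"
    and "lead_coeff A = 1" and "lead_coeff B = 1"
    and "coprime (map_poly of_int A :: rat poly) (map_poly of_int B)"
    and "degree A = d" and "degree B = e"
    and "split_simple_roots_mod p A" and "split_simple_roots_mod p B"
    and "\<omega> = max_gcd_exponent p A B"
    and "pairwise (\<lambda>i j. [r i \<noteq> r j] (mod p)) {1..d}"
    and "poly_cong A (\<Prod>i = 1..d. [:- r i, 1:]) (p ^ \<omega>)"
    and "pairwise (\<lambda>i j. [s i \<noteq> s j] (mod p)) {1..e}"
    and "poly_cong B (\<Prod>j = 1..e. [:- s j, 1:]) (p ^ \<omega>)"
  shows "(\<forall>i\<in>{1..d}. \<forall>j\<in>{1..e}. [n = r i] (mod p) \<and> [r i = s j] (mod p) \<longrightarrow>
            gcd (poly A n) (gcd (poly B n) (p ^ \<omega>)) = gcd (n - r i) (gcd (r i - s j) (p ^ \<omega>)))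
       \<and> (\<not> (\<exists>i\<in>{1..d}. \<exists>j\<in>{1..e}. [n = r i] (mod p) \<and> [r i = s j] (mod p)) \<longrightarrow>
            gcd (poly A n) (gcd (poly B n) (p ^ \<omega>)) = 1)"
proof (intro conjI ballI impI)
  fix i j
  assume i: "i \<in> {1..d}" and j: "j \<in> {1..e}"
    and c: "[n = r i] (mod p) \<and> [r i = s j] (mod p)"
  have "gcd (poly A n) (p ^ \<omega>) = gcd (n - r i) (p ^ \<omega>)"
    using assms(1,10,11) i c by (intro gcd_poly_eq_gcd_root) auto
  moreover have "gcd (poly B n) (p ^ \<omega>) = gcd (n - s j) (p ^ \<omega>)"
    using assms(1,12,13) j c by (intro gcd_poly_eq_gcd_root) (auto intro: cong_trans)
  ultimately have "gcd (poly A n) (gcd (poly B n) (p ^ \<omega>)) = gcd (n - r i) (gcd (n - s j) (p ^ \<omega>))"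
    by (metis gcd.left_commute)
  \<comment> \<open>Splitting \<open>n - s j\<close> at \<open>r i\<close> lets the summand
    \<open>n - r i\<close> be absorbed by the first argument of the inner gcd.\<close>
  also have "\<dots> = gcd (gcd (n - r i) ((n - r i) + (r i - s j))) (p ^ \<omega>)"
    by (simp add: gcd.assoc)
  also have "\<dots> = gcd (n - r i) (gcd (r i - s j) (p ^ \<omega>))"
    by (simp only: gcd_add2) (rule gcd.assoc)
  finally show "gcd (poly A n) (gcd (poly B n) (p ^ \<omega>)) = gcd (n - r i) (gcd (r i - s j) (p ^ \<omega>))" .
next
  assume no: "\<not> (\<exists>i\<in>{1..d}. \<exists>j\<in>{1..e}. [n = r i] (mod p) \<and> [r i = s j] (mod p))"
  \<comment> \<open>If both failed, \<open>n\<close> would be congruent to some \<open>r i\<close>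
    and to some \<open>s j\<close>, which makes these two congruent to each other.\<close>
  have "coprime (poly A n) (p ^ \<omega>) \<or> coprime (poly B n) (p ^ \<omega>)"
  proof (rule ccontr)
    assume "\<not> ?thesis"
    then obtain i j where "i \<in> {1..d}" "[n = r i] (mod p)" "j \<in> {1..e}" "[n = s j] (mod p)"
      using exists_root_if_not_coprime assms(1,11,13) by metis
    then show False
      using no by (meson cong_sym cong_trans)
  qed
  then show "gcd (poly A n) (gcd (poly B n) (p ^ \<omega>)) = 1"
    by (metis coprime_iff_gcd_eq_1 gcd.left_commute gcd_1_int)
qed

end
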